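(* Let $\pi_0$ be uniform on a finite control grid of $N_u$ points, and let $V,V'$ be bounded. Let $\mathcal T$ be the exact Bellman operator and $\mathcal T^{\eta}$ the entropic Bellman operator at temperature $\eta>0$ (both defined in the context). Then, pointwise: (i) $\mathcal T V \le \mathcal T^{\eta} V \le \mathcal T V + \eta\log N_u$; (ii) $V\le V'$ implies $\mathcal T^{\eta}V\le \mathcal T^{\eta}V'$, and $\mathcal T^{\eta}$ is a $\delta$-contraction in the sup norm; (iii) if $V^*$ and $V^{\eta}$ denote the (periodic) fixed points of $\mathcal T$ and $\mathcal T^{\eta}$, then $$0\le V^{\eta}-V^*\le \frac{\eta\log N_u}{1-\delta}.$$
   Context: Stages $t$ are weeks of the year, $t\in\{0,\dots,51\}$, with periodic indexing (stage $52$ is identified with stage $0$). Stage length is $\Delta=1/52$, the discount rate is $\rho>0$, and $\delta=e^{-\rho\Delta}\in(0,1)$ is the per-stage discount. The exogenous driver (inflow) takes finitely many node values $q_{t,j}$ indexed by $j\in\{1,\dots,N\}$, with row-stochastic transition matrices $P_t[j,j']$. The storage is $s\in[0,S_{\max}]$. A function $V$ is a family $V_{t,j}:[0,S_{\max}]\to\mathbb R$. For a release $u$, the next storage is $s'=s+(q_{t,j}-u-w)\Delta\in[0,S_{\max}]$, where $w\ge 0$ is the spill induced at the upper storage bound, and $c_{t,j}(s,u)\ge 0$ is the (bounded) stage cost. Let $\mathcal U_{t,j}(s)$ be the set of admissible controls, here a finite grid of $N_u$ admissible releases, and let $\pi_0$ be the uniform probability measure on this grid. The risk-neutral aggregation is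 $\mathcal R_{t,j}(v)=\sum_{j'}P_t[j,j']v_{j'}$. Put $$G(s,u)=c_{t,j}(s,u)+\delta\,\mathcal R_{t,j}\big(V_{t+1,\cdot}(s')\big).$$ The exact Bellman operator is $$(\mathcal T_{t,j}V)(s)=\min_{u\in\mathcal U_{t,j}(s)}G(s,u),$$ and the entropic Bellman operator at temperature $\eta>0$ is $$(\mathcal T^{\eta}_{t,j}V)(s)=\min_{\pi}\Big\{\mathbb E_{u\sim\pi}[G(s,u)]+\eta D_{\mathrm{KL}}(\pi\|\pi_0)\Big\}=-\eta\log\mathbb E_{u\sim\pi_0}\big[\exp(-G(s,u)/\eta)\big],$$ where $\pi$ ranges over probability measures on the control set and $D_{\mathrm{KL}}(\pi\|\pi_0)$ is relative entropy. The (periodic) fixed points are taken among bounded families $V$ with the periodic stage indexing. *)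

theory Defs
  imports "HOL-Probability.Probability"
begin

record reservoir_data =
  rho   :: real                                     \<comment> \<open>discount rate\<close>
  smax  :: real                                     \<comment> \<open>storage capacity\<close>
  nodes :: nat                                      \<comment> \<open>number \<open>N\<close> of driver nodes\<close>
  infl  :: "nat \<Rightarrow> nat \<Rightarrow> real"                     \<comment> \<open>inflow \<open>q\<^bsub>t,j\<^esub>\<close>\<close>
  trans_mat :: "nat \<Rightarrow> nat \<Rightarrow> nat \<Rightarrow> real"         \<comment> \<open>transition matrix \<open>P\<^sub>t[j,j']\<close>\<close>
  cost  :: "nat \<Rightarrow> nat \<Rightarrow> real \<Rightarrow> real \<Rightarrow> real"     \<comment> \<open>stage cost \<open>c\<^bsub>t,j\<^esub>(s,u)\<close>\<close>
  grid  :: "nat \<Rightarrow> nat \<Rightarrow> real \<Rightarrow> real set"         \<comment> \<open>admissible releases \<open>U\<^bsub>t,j\<^esub>(s)\<close>\<close>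
  grid_size :: nat                                  \<comment> \<open>number \<open>N\<^sub>u\<close> of grid points\<close>

text \<open>
  A family \<open>V\<^bsub>t,j\<^esub> : [0, smax] \<rightarrow> \<real>\<close> is a curried function of \<open>t\<close>, \<open>j\<close>, \<open>s\<close>; only its
  values on \<open>states M\<close> matter.
\<close>

type_synonym family = "nat \<Rightarrow> nat \<Rightarrow> real \<Rightarrow> real"

definition stage_length :: real where
  "stage_length = 1 / 52"

definition discount :: "reservoir_data \<Rightarrow> real" where
  "discount M = exp (- rho M * stage_length)"

definition next_stage :: "nat \<Rightarrow> nat" where
  "next_stage t = (t + 1) mod 52"

definition states :: "reservoir_data \<Rightarrow> (nat \<times> nat \<times> real) set" where
  "states M = {0..51} \<times> {1..nodes M} \<times> {0..smax M}"

text \<open>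
  The spill is the rate at which the excess over \<open>smax\<close> has to be discharged, and is
  zero if there is no excess.
\<close>

definition spill :: "reservoir_data \<Rightarrow> nat \<Rightarrow> nat \<Rightarrow> real \<Rightarrow> real \<Rightarrow> real" where
  "spill M t j s u =
     max 0 ((s + (infl M t j - u) * stage_length - smax M) / stage_length)"

definition next_storage :: "reservoir_data \<Rightarrow> nat \<Rightarrow> nat \<Rightarrow> real \<Rightarrow> real \<Rightarrow> real" where
  "next_storage M t j s u = s + (infl M t j - u - spill M t j s u) * stage_length"

locale reservoir =
  fixes M :: reservoir_data
  assumes rho_pos: "rho M > 0"
    and smax_nonneg: "smax M \<ge> 0"
    and nodes_pos: "nodes M \<ge> 1"
    and trans_nonneg:
      "\<And>t j j'. \<lbrakk>t \<in> {0..51}; j \<in> {1..nodes M}; j' \<in> {1..nodes M}\<rbrakk> \<Longrightarrow> trans_mat M t j j' \<ge> 0"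
    and trans_row_sum:
      "\<And>t j. \<lbrakk>t \<in> {0..51}; j \<in> {1..nodes M}\<rbrakk> \<Longrightarrow> (\<Sum>j'=1..nodes M. trans_mat M t j j') = 1"
    and grid_size_pos: "grid_size M \<ge> 1"
    and grid_finite: "\<And>t j s. (t, j, s) \<in> states M \<Longrightarrow> finite (grid M t j s)"
    and grid_card: "\<And>t j s. (t, j, s) \<in> states M \<Longrightarrow> card (grid M t j s) = grid_size M"
    and grid_admissible:
      "\<And>t j s u. \<lbrakk>(t, j, s) \<in> states M; u \<in> grid M t j s\<rbrakk>
        \<Longrightarrow> next_storage M t j s u \<in> {0..smax M}"
    and cost_nonneg:
      "\<And>t j s u. \<lbrakk>(t, j, s) \<in> states M; u \<in> grid M t j s\<rbrakk> \<Longrightarrow> cost M t j s u \<ge> 0"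
    and cost_bounded:
      "\<exists>C. \<forall>(t, j, s) \<in> states M. \<forall>u \<in> grid M t j s. cost M t j s u \<le> C"

definition risk_neutral :: "reservoir_data \<Rightarrow> nat \<Rightarrow> nat \<Rightarrow> (nat \<Rightarrow> real) \<Rightarrow> real" where
  "risk_neutral M t j v = (\<Sum>j'=1..nodes M. trans_mat M t j j' * v j')"

definition Gfun :: "reservoir_data \<Rightarrow> family \<Rightarrow> nat \<Rightarrow> nat \<Rightarrow> real \<Rightarrow> real \<Rightarrow> real" where
  "Gfun M V t j s u =
     cost M t j s u +
     discount M * risk_neutral M t j (\<lambda>j'. V (next_stage t) j' (next_storage M t j s u))"

definition bellman :: "reservoir_data \<Rightarrow> family \<Rightarrow> family" where
  "bellman M V t j s = Min (Gfun M V t j s ` grid M t j s)"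

text \<open>
  Relative entropy \<open>D\<^sub>K\<^sub>L(p \<parallel> p0)\<close> with the natural logarithm. The library's
  \<^const>\<open>KL_divergence\<close> takes the reference measure first.
\<close>

definition rel_entropy :: "'a pmf \<Rightarrow> 'a pmf \<Rightarrow> real" where
  "rel_entropy p p0 = KL_divergence (exp 1) (measure_pmf p0) (measure_pmf p)"

definition free_energy :: "real \<Rightarrow> 'a set \<Rightarrow> ('a \<Rightarrow> real) \<Rightarrow> 'a pmf \<Rightarrow> real" where
  "free_energy \<eta> U g p =
     measure_pmf.expectation p g + \<eta> * rel_entropy p (pmf_of_set U)"

text \<open>
  Probability measures on the finite grid are the PMFs supported in it. The infimum is
  a minimum and has the log-sum-exp form, see \<open>entropic_bellman_min\<close> and
  \<open>entropic_bellman_closed_form\<close> below.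
\<close>

definition entropic_bellman :: "reservoir_data \<Rightarrow> real \<Rightarrow> family \<Rightarrow> family" where
  "entropic_bellman M \<eta> V t j s =
     (INF p \<in> {p. set_pmf p \<subseteq> grid M t j s}. free_energy \<eta> (grid M t j s) (Gfun M V t j s) p)"

definition bounded_family :: "reservoir_data \<Rightarrow> family \<Rightarrow> bool" where
  "bounded_family M V \<longleftrightarrow> bounded ((\<lambda>(t, j, s). V t j s) ` states M)"

definition sup_norm :: "reservoir_data \<Rightarrow> family \<Rightarrow> real" where
  "sup_norm M V = (SUP (t, j, s) \<in> states M. \<bar>V t j s\<bar>)"

text \<open>
  A contraction maps the space of bounded families to itself, so that
  \<^const>\<open>sup_norm\<close> is only applied to bounded families.
\<close>

definition sup_norm_contraction ::
    "reservoir_data \<Rightarrow> real \<Rightarrow> (family \<Rightarrow> family) \<Rightarrow> bool" where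
  "sup_norm_contraction M k F \<longleftrightarrow>
     0 \<le> k \<and> k < 1 \<and>
     (\<forall>V. bounded_family M V \<longrightarrow> bounded_family M (F V)) \<and>
     (\<forall>V V'. bounded_family M V \<longrightarrow> bounded_family M V' \<longrightarrow>
        sup_norm M (\<lambda>t j s. F V t j s - F V' t j s)
          \<le> k * sup_norm M (\<lambda>t j s. V t j s - V' t j s))"

definition fixed_point ::
    "reservoir_data \<Rightarrow> (family \<Rightarrow> family) \<Rightarrow> family \<Rightarrow> bool" where
  "fixed_point M F V \<longleftrightarrow>
     bounded_family M V \<and> (\<forall>(t, j, s) \<in> states M. F V t j s = V t j s)"

subsection \<open>The Gibbs variational principle on a finite set\<close>

lemma rel_entropy_uniform:
  assumes "finite U" "U \<noteq> {}" "set_pmf p \<subseteq> U"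
  shows "rel_entropy p (pmf_of_set U) = (\<Sum>u\<in>U. pmf p u * ln (card U * pmf p u))"
proof -
  let ?p0 = "pmf_of_set U"
  let ?f = "\<lambda>u. card U * pmf p u"
  have cp: "real (card U) > 0" using assms by (simp add: card_gt_0_iff)
  have "measure_pmf p = density (measure_pmf ?p0) (\<lambda>u. ennreal (?f u))"
  proof (rule measure_eqI)
    fix A
    have "emeasure (density (measure_pmf ?p0) (\<lambda>u. ennreal (?f u))) A
        = (\<integral>\<^sup>+u. ennreal (?f u) * indicator A u \<partial>measure_pmf ?p0)"
      by (simp add: emeasure_density)
    also have "\<dots> = (\<Sum>u\<in>U. ennreal (?f u) * indicator A u * ennreal (pmf ?p0 u))"
      using assms by (subst nn_integral_measure_pmf_support[of U]) auto
    also have "\<dots> = (\<Sum>u\<in>U. ennreal (pmf p u * indicator A u))"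
    proof (rule sum.cong[OF refl])
      fix u assume "u \<in> U"
      then have "?f u * pmf ?p0 u = pmf p u" using assms cp by simp
      then show "ennreal (?f u) * indicator A u * ennreal (pmf ?p0 u)
          = ennreal (pmf p u * indicator A u)"
        by (auto simp: indicator_def ennreal_mult[symmetric] simp del: pmf_of_set)
    qed
    also have "\<dots> = (\<Sum>u\<in>U. indicator A u * ennreal (pmf p u))"
      by (intro sum.cong) (auto simp: indicator_def)
    also have "\<dots> = (\<integral>\<^sup>+u. indicator A u \<partial>measure_pmf p)"
      using assms by (subst nn_integral_measure_pmf_support[of U]) (auto simp: set_pmf_iff)
    finally show "emeasure (measure_pmf p) A
        = emeasure (density (measure_pmf ?p0) (\<lambda>u. ennreal (?f u))) A"
      by simp
  qed simp
  then have "rel_entropy p ?p0 = (\<integral>u. ?f u * log (exp 1) (?f u) \<partial>measure_pmf ?p0)"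
    unfolding rel_entropy_def
    by (simp del: of_nat_mult) (rule sigma_finite_measure.KL_density[OF prob_space_imp_sigma_finite[OF prob_space_measure_pmf]], auto)
  also have "\<dots> = (\<Sum>u\<in>U. ?f u * log (exp 1) (?f u) * pmf ?p0 u)"
    using assms by (subst integral_measure_pmf_real[of U]) auto
  also have "\<dots> = (\<Sum>u\<in>U. pmf p u * ln (card U * pmf p u))"
    using assms cp by (intro sum.cong) (auto simp: log_def)
  finally show ?thesis .
qed

lemma gibbs_variational:
  fixes g :: "'a \<Rightarrow> real" and \<eta> :: real
  assumes U: "finite U" "U \<noteq> {}" and \<eta>: "\<eta> > 0"
  defines "L \<equiv> - \<eta> * ln (measure_pmf.expectation (pmf_of_set U) (\<lambda>u. exp (- g u / \<eta>)))"
  shows "\<And>p. set_pmf p \<subseteq> U \<Longrightarrow> L \<le> free_energy \<eta> U g p"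
    and "\<exists>p. set_pmf p \<subseteq> U \<and> free_energy \<eta> U g p = L"
proof -
  define n where "n = real (card U)"
  define Z where "Z = (\<Sum>u\<in>U. exp (- g u / \<eta>))"
  define q where "q u = (if u \<in> U then exp (- g u / \<eta>) / Z else 0)" for u
  have n: "n > 0" using U by (simp add: card_gt_0_iff n_def)
  have Z: "Z > 0" unfolding Z_def using U by (intro sum_pos) auto
  have q: "q u > 0" if "u \<in> U" for u using that Z by (simp add: q_def)
  have q1: "(\<Sum>u\<in>U. q u) = 1"
    using Z Z_def by (simp add: q_def sum_divide_distrib[symmetric])
  have L: "L = - \<eta> * ln (Z / n)"
    unfolding L_def using U
    by (simp add: integral_pmf_of_set Z_def n_def)
  have energy: "free_energy \<eta> U g p = L + \<eta> * (\<Sum>u\<in>U. pmf p u * ln (pmf p u / q u))"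
    if p: "set_pmf p \<subseteq> U" for p
  proof -
    have p1: "(\<Sum>u\<in>U. pmf p u) = 1" using U p by (intro sum_pmf_eq_1) auto
    have "free_energy \<eta> U g p
        = (\<Sum>u\<in>U. g u * pmf p u) + \<eta> * (\<Sum>u\<in>U. pmf p u * ln (n * pmf p u))"
      unfolding free_energy_def n_def using rel_entropy_uniform[OF U p] p U
      by (subst integral_measure_pmf_real[of U]) auto
    also have "\<dots> = (\<Sum>u\<in>U. g u * pmf p u + \<eta> * (pmf p u * ln (n * pmf p u)))"
      by (simp add: sum.distrib sum_distrib_left)
    also have "\<dots> = (\<Sum>u\<in>U. pmf p u * L + \<eta> * (pmf p u * ln (pmf p u / q u)))"
    proof (rule sum.cong[OF refl])
      fix u assume u: "u \<in> U"
      show "g u * pmf p u + \<eta> * (pmf p u * ln (n * pmf p u))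
          = pmf p u * L + \<eta> * (pmf p u * ln (pmf p u / q u))"
      proof (cases "pmf p u = 0")
        case False
        then have pp: "pmf p u > 0" by (simp add: less_le)
        have "ln (q u) = - g u / \<eta> - ln Z" using u Z by (simp add: q_def ln_div)
        then have "\<eta> * ln (pmf p u / q u) = \<eta> * ln (pmf p u) + g u + \<eta> * ln Z"
          using pp q[OF u] \<eta> by (simp add: ln_div field_simps)
        moreover have "L = - \<eta> * ln Z + \<eta> * ln n"
          using L Z n by (simp add: ln_div algebra_simps)
        moreover have "ln (n * pmf p u) = ln n + ln (pmf p u)" using pp n by (simp add: ln_mult)
        ultimately have "g u + \<eta> * ln (n * pmf p u) = L + \<eta> * ln (pmf p u / q u)"
          by (simp add: algebra_simps)
        then have "pmf p u * (g u + \<eta> * ln (n * pmf p u))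
            = pmf p u * (L + \<eta> * ln (pmf p u / q u))" by simp
        then show ?thesis by (simp add: algebra_simps)
      qed simp
    qed
    also have "\<dots> = (\<Sum>u\<in>U. pmf p u) * L + \<eta> * (\<Sum>u\<in>U. pmf p u * ln (pmf p u / q u))"
      by (simp add: sum.distrib sum_distrib_left sum_distrib_right)
    finally show ?thesis using p1 by simp
  qed
  show "L \<le> free_energy \<eta> U g p" if p: "set_pmf p \<subseteq> U" for p
  proof -
    have p1: "(\<Sum>u\<in>U. pmf p u) = 1" using U p by (intro sum_pmf_eq_1) auto
    have "pmf p u - q u \<le> pmf p u * ln (pmf p u / q u)" if u: "u \<in> U" for u
    proof (cases "pmf p u = 0")
      case True
      then show ?thesis using q[OF u] by simp
    next
      case False
      then have pp: "pmf p u > 0" by (simp add: less_le)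
      have "ln (q u / pmf p u) \<le> q u / pmf p u - 1"
        using pp q[OF u] by (intro ln_le_minus_one) simp
      then have "1 - q u / pmf p u \<le> ln (pmf p u / q u)"
        using pp q[OF u] by (simp add: ln_div)
      then have "pmf p u * (1 - q u / pmf p u) \<le> pmf p u * ln (pmf p u / q u)"
        using pp by (intro mult_left_mono) auto
      then show ?thesis using pp by (simp add: algebra_simps)
    qed
    then have "(\<Sum>u\<in>U. pmf p u - q u) \<le> (\<Sum>u\<in>U. pmf p u * ln (pmf p u / q u))"
      by (rule sum_mono)
    then have "0 \<le> (\<Sum>u\<in>U. pmf p u * ln (pmf p u / q u))"
      using p1 q1 by (simp add: sum_subtractf)
    then show ?thesis using energy[OF p] \<eta> by simp
  qed
  show "\<exists>p. set_pmf p \<subseteq> U \<and> free_energy \<eta> U g p = L"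
  proof -
    have q0: "q u \<ge> 0" for u using q[of u] by (cases "u \<in> U") (auto simp: q_def)
    have fin: "{u. q u \<noteq> 0} \<subseteq> U" by (auto simp: q_def)
    have "(\<integral>\<^sup>+u. ennreal (q u) \<partial>count_space UNIV) = (\<Sum>u\<in>U. ennreal (q u))"
      using U fin by (intro nn_integral_count_space') (auto simp: q_def)
    also have "\<dots> = 1" using q0 q1 by (simp add: sum_ennreal)
    finally have pq: "pmf (embed_pmf q) u = q u" for u
      using q0 by (intro pmf_embed_pmf) auto
    have sub: "set_pmf (embed_pmf q) \<subseteq> U" using fin pq by (auto simp: set_pmf_iff)
    have "(\<Sum>u\<in>U. pmf (embed_pmf q) u * ln (pmf (embed_pmf q) u / q u)) = 0"
      using q by (intro sum.neutral) (auto simp: pq)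
    then show ?thesis using sub energy[OF sub] by auto
  qed
qed

context reservoir
begin

lemma grid_nonempty: "(t, j, s) \<in> states M \<Longrightarrow> grid M t j s \<noteq> {}"
  using grid_card[of t j s] grid_size_pos by auto

lemma entropic_bellman_closed_form:
  assumes "(t, j, s) \<in> states M" "\<eta> > 0"
  shows "entropic_bellman M \<eta> V t j s =
    - \<eta> * ln (measure_pmf.expectation (pmf_of_set (grid M t j s))
                 (\<lambda>u. exp (- Gfun M V t j s u / \<eta>)))"
  unfolding entropic_bellman_def
  using gibbs_variational[OF grid_finite grid_nonempty assms(2), OF assms(1) assms(1)]
  by (intro cInf_eq_minimum) (auto simp: image_iff, metis)

lemma entropic_bellman_min:
  assumes "(t, j, s) \<in> states M" "\<eta> > 0"
  shows "\<exists>p. set_pmf p \<subseteq> grid M t j s \<and>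
    entropic_bellman M \<eta> V t j s = free_energy \<eta> (grid M t j s) (Gfun M V t j s) p"
    and "set_pmf p \<subseteq> grid M t j s \<Longrightarrow>
    entropic_bellman M \<eta> V t j s \<le> free_energy \<eta> (grid M t j s) (Gfun M V t j s) p"
  using gibbs_variational[OF grid_finite grid_nonempty assms(2), OF assms(1) assms(1)]
  unfolding entropic_bellman_closed_form[OF assms] by metis+

end

end

theory Submission
  imports Defs
begin

text \<open>
  Everything rests on two properties of the soft minimum: it lies between the minimum and the
  minimum plus \<open>\<eta> ln N\<^sub>u\<close>, and it is monotone and commutes with the addition of constants.
  Hence \<open>V \<le> V' + d\<close> implies \<open>T\<^sup>\<eta> V \<le> T\<^sup>\<eta> V' + \<delta> d\<close>, which for \<open>d = 0\<close> is monotonicity and for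
  \<open>d\<close> the distance of \<open>V\<close> and \<open>V'\<close> is the contraction property. For the fixed points, the supremum
  \<open>d\<close> of \<open>V\<^sup>\<eta> - V\<^sup>*\<close> satisfies \<open>d \<le> \<eta> ln N\<^sub>u + \<delta> d\<close>, and that of \<open>V\<^sup>* - V\<^sup>\<eta>\<close> satisfies \<open>d \<le> \<delta> d\<close>.
\<close>

section \<open>The soft minimum over a finite set\<close>

text \<open>This is the closed form of the Gibbs variational problem with uniform prior. Encoding it
  this way reduces the estimates to finite sums of exponentials.\<close>

definition soft_min :: "real \<Rightarrow> 'a set \<Rightarrow> ('a \<Rightarrow> real) \<Rightarrow> real" where
  "soft_min \<eta> U g = - \<eta> * ln (measure_pmf.expectation (pmf_of_set U) (\<lambda>u. exp (- g u / \<eta>)))"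

text \<open>Adding \<open>c\<close> to the energy multiplies every Boltzmann weight by the same
  factor \<open>exp (- c / \<eta>)\<close>. This factor leaves the average, and the decreasing map
  \<open>- \<eta> * ln\<close> turns it back into the summand \<open>c\<close>.\<close>

lemma soft_min_le_add:
  assumes U: "finite U" "U \<noteq> {}" and \<eta>: "\<eta> > 0"
    and le: "\<And>u. u \<in> U \<Longrightarrow> g u \<le> h u + c"
  shows "soft_min \<eta> U g \<le> soft_min \<eta> U h + c"
proof -
  define E where "E f = (\<Sum>u\<in>U. exp (- f u / \<eta>)) / card U" for f
  have cp: "real (card U) > 0" using U by (simp add: card_gt_0_iff)
  have E: "soft_min \<eta> U f = - \<eta> * ln (E f)" for f
    using U by (simp add: soft_min_def E_def integral_pmf_of_set)
  have Epos: "E f > 0" for f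
    unfolding E_def using U cp by (intro divide_pos_pos sum_pos) auto
  have "exp (- c / \<eta>) * exp (- h u / \<eta>) = exp (- (h u + c) / \<eta>)" for u
    by (simp add: diff_divide_distrib flip: exp_add)
  then have "exp (- c / \<eta>) * E h = (\<Sum>u\<in>U. exp (- (h u + c) / \<eta>)) / card U"
    unfolding E_def times_divide_eq_right sum_distrib_left by simp
  also have "\<dots> \<le> E g"
    unfolding E_def using le \<eta>
    by (intro divide_right_mono sum_mono iffD2[OF exp_le_cancel_iff])
       (simp_all del: minus_add_distrib)
  finally have "ln (exp (- c / \<eta>) * E h) \<le> ln (E g)"
    using Epos[of h] Epos[of g] by (subst ln_le_cancel_iff) auto
  then have "- c / \<eta> + ln (E h) \<le> ln (E g)"
    using Epos[of h] by (simp add: ln_mult)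
  then have "\<eta> * (- c / \<eta> + ln (E h)) \<le> \<eta> * ln (E g)"
    using \<eta> by (intro mult_left_mono) auto
  then show ?thesis using \<eta> by (simp add: E algebra_simps)
qed

lemma soft_min_const:
  assumes "finite U" "U \<noteq> {}" "\<eta> > 0"
  shows "soft_min \<eta> U (\<lambda>_. c) = c"
  using assms by (simp add: soft_min_def)

text \<open>Compare \<open>g\<close> with the constant function at its minimum, which lies below
  \<open>g\<close> and is its own soft minimum.\<close>

lemma Min_le_soft_min:
  assumes "finite U" "U \<noteq> {}" "\<eta> > 0"
  shows "Min (g ` U) \<le> soft_min \<eta> U g"
  using soft_min_le_add[of U \<eta> "\<lambda>_. Min (g ` U)" g 0] soft_min_const[of U \<eta>] assms by simp

text \<open>Of the sum of positive weights keep only the term of a minimiser. Its share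
  \<open>1 / card U\<close> in the uniform average costs exactly the logarithmic term.\<close>

lemma soft_min_le_Min:
  assumes U: "finite U" "U \<noteq> {}" and \<eta>: "\<eta> > 0"
  shows "soft_min \<eta> U g \<le> Min (g ` U) + \<eta> * ln (card U)"
proof -
  have "Min (g ` U) \<in> g ` U" using U by (intro Min_in) auto
  then obtain v where v: "v \<in> U" "Min (g ` U) = g v" by auto
  have cp: "real (card U) > 0" using U by (simp add: card_gt_0_iff)
  have "exp (- g v / \<eta>) \<le> (\<Sum>u\<in>U. exp (- g u / \<eta>))"
    using U v by (intro member_le_sum) auto
  then have "exp (- g v / \<eta>) / card U \<le> (\<Sum>u\<in>U. exp (- g u / \<eta>)) / card U"
    by (rule divide_right_mono) simp
  also have "\<dots> = measure_pmf.expectation (pmf_of_set U) (\<lambda>u. exp (- g u / \<eta>))"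
    using U by (simp add: integral_pmf_of_set)
  finally have le: "exp (- g v / \<eta>) / card U
      \<le> measure_pmf.expectation (pmf_of_set U) (\<lambda>u. exp (- g u / \<eta>))" (is "?a \<le> ?b") .
  moreover have "?a > 0" using cp by simp
  ultimately have "ln ?a \<le> ln ?b" by (subst ln_le_cancel_iff) auto
  then have "- g v / \<eta> - ln (card U) \<le> ln ?b" using cp by (simp add: ln_div)
  then have "\<eta> * (- g v / \<eta> - ln (card U)) \<le> \<eta> * ln ?b"
    using \<eta> by (intro mult_left_mono) auto
  then show ?thesis using \<eta> v by (simp add: soft_min_def algebra_simps)
qed

section \<open>Shift estimates for the Bellman operators\<close>

context reservoir
begin

lemma discount_pos: "0 < discount M" and discount_less_1: "discount M < 1"
  using rho_pos by (auto simp: discount_def stage_length_def)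

text \<open>The point \<open>(0, 1, 0)\<close> is a state. Bounding a real supremum from above by
  \<open>cSUP_least\<close> requires a nonempty index set.\<close>

lemma states_nonempty: "states M \<noteq> {}"
  using smax_nonneg nodes_pos by (auto simp: states_def)

text \<open>The wrap-around modulo 52 keeps the stage in range, and admissibility does so for the
  storage. Bounds on \<open>states M\<close> thus apply to continuation values.\<close>

lemma next_state:
  assumes "(t, j, s) \<in> states M" "u \<in> grid M t j s" "j' \<in> {1..nodes M}"
  shows "(next_stage t, j', next_storage M t j s u) \<in> states M"
proof -
  have "next_stage t \<le> 51" unfolding next_stage_def by (simp add: less_Suc_eq_le[symmetric])
  then show ?thesis using grid_admissible[OF assms(1,2)] assms(3) by (simp add: states_def)
qed

text \<open>The stage costs agree on both sides. A row of the transition matrix is a probability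
  vector, so averaging preserves the order and passes \<open>d\<close> on unchanged; only the
  discount scales it.\<close>

lemma Gfun_le_add:
  assumes x: "(t, j, s) \<in> states M" and u: "u \<in> grid M t j s"
    and le: "\<And>t j s. (t, j, s) \<in> states M \<Longrightarrow> V t j s \<le> V' t j s + d"
  shows "Gfun M V t j s u \<le> Gfun M V' t j s u + discount M * d"
proof -
  have tj: "t \<in> {0..51}" "j \<in> {1..nodes M}" using x by (auto simp: states_def)
  let ?v = "\<lambda>V j'. V (next_stage t) j' (next_storage M t j s u)"
  have "risk_neutral M t j (?v V) \<le> (\<Sum>j'=1..nodes M. trans_mat M t j j' * (?v V' j' + d))"
    unfolding risk_neutral_def
    using trans_nonneg[OF tj] le[OF next_state[OF x u]] by (intro sum_mono mult_left_mono) auto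
  also have "\<dots> = risk_neutral M t j (?v V') + d"
    using trans_row_sum[OF tj]
    by (simp add: risk_neutral_def distrib_left sum.distrib sum_distrib_right[symmetric])
  finally have "discount M * risk_neutral M t j (?v V)
      \<le> discount M * (risk_neutral M t j (?v V') + d)"
    using discount_pos by (intro mult_left_mono) auto
  then show ?thesis by (simp add: Gfun_def distrib_left)
qed

lemma entropic_bellman_soft_min:
  assumes "(t, j, s) \<in> states M" "\<eta> > 0"
  shows "entropic_bellman M \<eta> V t j s = soft_min \<eta> (grid M t j s) (Gfun M V t j s)"
  using entropic_bellman_closed_form[OF assms] by (simp add: soft_min_def)

text \<open>The estimate is one-sided and \<open>d\<close> may have either sign, as for the gap of
  the fixed points, where \<open>d\<close> is any upper bound of a difference.\<close>

lemma entropic_bellman_le_add: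
  assumes "(t, j, s) \<in> states M" "\<eta> > 0"
    and "\<And>t j s. (t, j, s) \<in> states M \<Longrightarrow> V t j s \<le> V' t j s + d"
  shows "entropic_bellman M \<eta> V t j s \<le> entropic_bellman M \<eta> V' t j s + discount M * d"
  unfolding entropic_bellman_soft_min[OF assms(1,2)]
  using assms by (intro soft_min_le_add grid_finite grid_nonempty Gfun_le_add) auto

lemma bellman_le_entropic_bellman:
  assumes "(t, j, s) \<in> states M" "\<eta> > 0"
  shows "bellman M V t j s \<le> entropic_bellman M \<eta> V t j s"
  unfolding entropic_bellman_soft_min[OF assms] bellman_def
  using assms by (intro Min_le_soft_min grid_finite grid_nonempty)

lemma entropic_bellman_le_bellman:
  assumes "(t, j, s) \<in> states M" "\<eta> > 0"
  shows "entropic_bellman M \<eta> V t j s \<le> bellman M V t j s + \<eta> * ln (grid_size M)"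
  using soft_min_le_Min[OF grid_finite[OF assms(1)] grid_nonempty[OF assms(1)] assms(2)]
  unfolding entropic_bellman_soft_min[OF assms] bellman_def grid_card[OF assms(1)] .

section \<open>Bounded families and contraction in the sup norm\<close>

lemma bounded_family_iff:
  "bounded_family M V \<longleftrightarrow> (\<exists>B. \<forall>t j s. (t, j, s) \<in> states M \<longrightarrow> \<bar>V t j s\<bar> \<le> B)"
  unfolding bounded_family_def bounded_iff
  by (intro arg_cong[of _ _ Ex] ext) fastforce

lemma bounded_familyI:
  assumes "\<And>t j s. (t, j, s) \<in> states M \<Longrightarrow> \<bar>V t j s\<bar> \<le> B"
  shows "bounded_family M V"
  using assms unfolding bounded_family_iff by blast

lemma bounded_family_diff:
  assumes "bounded_family M V" "bounded_family M V'"
  shows "bounded_family M (\<lambda>t j s. V t j s - V' t j s)"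
proof -
  obtain B B' where
    "\<And>t j s. (t, j, s) \<in> states M \<Longrightarrow> \<bar>V t j s\<bar> \<le> B"
    "\<And>t j s. (t, j, s) \<in> states M \<Longrightarrow> \<bar>V' t j s\<bar> \<le> B'"
    using assms unfolding bounded_family_iff by blast
  then show ?thesis
    by (intro bounded_familyI[where B = "B + B'"] order.trans[OF abs_triangle_ineq4] add_mono)
qed

text \<open>Boundedness supplies \<open>bdd_above\<close>, which makes the real supremum an upper
  bound.\<close>

lemma abs_le_sup_norm:
  assumes "bounded_family M V" "(t, j, s) \<in> states M"
  shows "\<bar>V t j s\<bar> \<le> sup_norm M V"
proof -
  obtain B where "\<And>t j s. (t, j, s) \<in> states M \<Longrightarrow> \<bar>V t j s\<bar> \<le> B"
    using assms(1) unfolding bounded_family_iff by blast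
  then have "bdd_above ((\<lambda>(t, j, s). \<bar>V t j s\<bar>) ` states M)"
    by (intro bdd_aboveI[where M = B]) auto
  from cSUP_upper[OF assms(2) this] show ?thesis by (simp add: sup_norm_def)
qed

lemma sup_norm_least:
  assumes "\<And>t j s. (t, j, s) \<in> states M \<Longrightarrow> \<bar>V t j s\<bar> \<le> B"
  shows "sup_norm M V \<le> B"
  unfolding sup_norm_def using assms by (intro cSUP_least[OF states_nonempty]) auto

lemma bounded_entropic_bellman:
  assumes \<eta>: "\<eta> > 0" and V: "bounded_family M V"
  shows "bounded_family M (entropic_bellman M \<eta> V)"
proof -
  obtain B where B: "\<And>t j s. (t, j, s) \<in> states M \<Longrightarrow> \<bar>V t j s\<bar> \<le> B"
    using V unfolding bounded_family_iff by blast
  obtain C where C: "\<And>t j s u. (t, j, s) \<in> states M \<Longrightarrow> u \<in> grid M t j s \<Longrightarrow> cost M t j s u \<le> C"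
    using cost_bounded by blast
  \<comment> \<open>The zero family serves as reference: its \<open>Gfun\<close> is the bare cost,
    so the shift estimate with \<open>d = B\<close> bounds \<open>Gfun\<close> for \<open>V\<close>
    from both sides.\<close>
  have G0: "Gfun M (\<lambda>_ _ _. 0) t j s u = cost M t j s u" for t j s u
    by (simp add: Gfun_def risk_neutral_def)
  show ?thesis
  proof (rule bounded_familyI)
    fix t j s assume x: "(t, j, s) \<in> states M"
    let ?U = "grid M t j s" and ?G = "Gfun M V t j s" and ?b = "C + discount M * B"
    \<comment> \<open>The lower bound is weakened by \<open>C\<close>, which is nonnegative as it
      dominates a nonnegative cost, so that the same \<open>?b\<close> serves on both sides.\<close>
    have G: "?G u \<le> ?b" "0 \<le> ?G u + ?b" if u: "u \<in> ?U" for u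
    proof -
      have "?G u \<le> Gfun M (\<lambda>_ _ _. 0) t j s u + discount M * B"
        using B by (intro Gfun_le_add[OF x u]) (simp add: abs_le_iff)
      moreover have "Gfun M (\<lambda>_ _ _. 0) t j s u \<le> ?G u + discount M * B"
        by (intro Gfun_le_add[OF x u]) (drule B, linarith)
      ultimately show "?G u \<le> ?b" "0 \<le> ?G u + ?b"
        using C[OF x u] cost_nonneg[OF x u] by (auto simp: G0)
    qed
    note U = grid_finite[OF x] grid_nonempty[OF x]
    have "soft_min \<eta> ?U ?G \<le> 0 + ?b"
      using soft_min_le_add[OF U \<eta>, of ?G "\<lambda>_. 0" ?b] G soft_min_const[OF U \<eta>] by simp
    moreover have "0 \<le> soft_min \<eta> ?U ?G + ?b"
      using soft_min_le_add[OF U \<eta>, of "\<lambda>_. 0" ?G ?b] G soft_min_const[OF U \<eta>] by simp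
    ultimately show "\<bar>entropic_bellman M \<eta> V t j s\<bar> \<le> ?b"
      unfolding entropic_bellman_soft_min[OF x \<eta>] by linarith
  qed
qed

lemma entropic_bellman_contraction:
  assumes \<eta>: "\<eta> > 0"
  shows "sup_norm_contraction M (discount M) (entropic_bellman M \<eta>)"
  unfolding sup_norm_contraction_def
proof (intro conjI allI impI)
  fix V V' assume V: "bounded_family M V" "bounded_family M V'"
  let ?d = "sup_norm M (\<lambda>t j s. V t j s - V' t j s)"
  have d: "\<bar>V t j s - V' t j s\<bar> \<le> ?d" if "(t, j, s) \<in> states M" for t j s
    using abs_le_sup_norm[OF bounded_family_diff[OF V] that] by simp
  show "sup_norm M (\<lambda>t j s. entropic_bellman M \<eta> V t j s - entropic_bellman M \<eta> V' t j s)
      \<le> discount M * ?d"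
  proof (rule sup_norm_least)
    fix t j s assume x: "(t, j, s) \<in> states M"
    \<comment> \<open>The distance enters as two one-sided shifts by \<open>?d\<close>, one in each
      direction.\<close>
    have "V t j s \<le> V' t j s + ?d" "V' t j s \<le> V t j s + ?d"
      if "(t, j, s) \<in> states M" for t j s
      using d[OF that] by linarith+
    from entropic_bellman_le_add[OF x \<eta>, of V V', OF this(1)]
      entropic_bellman_le_add[OF x \<eta>, of V' V, OF this(2)]
    show "\<bar>entropic_bellman M \<eta> V t j s - entropic_bellman M \<eta> V' t j s\<bar> \<le> discount M * ?d"
      by linarith
  qed
qed (use discount_pos discount_less_1 bounded_entropic_bellman[OF \<eta>] in auto)

section \<open>The gap between the fixed points\<close>

text \<open>The supremum of \<open>W\<close> is finite and is itself an admissible \<open>d\<close>.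
  The resulting inequality can be solved for it because the discount is below 1.\<close>

lemma bounded_family_self_improving:
  assumes W: "bounded_family M W"
    and step: "\<And>d t j s. (\<And>t j s. (t, j, s) \<in> states M \<Longrightarrow> W t j s \<le> d) \<Longrightarrow>
      (t, j, s) \<in> states M \<Longrightarrow> W t j s \<le> e + discount M * d"
    and x: "(t, j, s) \<in> states M"
  shows "W t j s \<le> e / (1 - discount M)"
proof -
  let ?S = "SUP (t, j, s) \<in> states M. W t j s"
  have "bdd_above ((\<lambda>(t, j, s). W t j s) ` states M)"
    using W by (simp add: bounded_family_def bounded_imp_bdd_above)
  note upper = cSUP_upper[OF _ this]
  have le: "W t j s \<le> ?S" if "(t, j, s) \<in> states M" for t j s
    using upper[OF that] by simp
  have "?S \<le> e + discount M * ?S"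
    using step[OF le] by (intro cSUP_least[OF states_nonempty]) auto
  then have "?S \<le> e / (1 - discount M)"
    using discount_less_1 by (simp add: pos_le_divide_eq algebra_simps)
  with le[OF x] show ?thesis by linarith
qed

text \<open>Both bounds pass through \<open>entropic_bellman M \<eta> V\<close>: its distance from
  \<open>V = bellman M V\<close> is controlled by the sandwich, and its distance from
  \<open>W\<close> by the shift estimate.\<close>

lemma fixed_point_gap:
  assumes \<eta>: "\<eta> > 0"
    and "fixed_point M (bellman M) V" and "fixed_point M (entropic_bellman M \<eta>) W"
    and x: "(t, j, s) \<in> states M"
  shows "0 \<le> W t j s - V t j s"
    and "W t j s - V t j s \<le> \<eta> * ln (grid_size M) / (1 - discount M)"
proof -
  have bdd: "bounded_family M V" "bounded_family M W"
    and V: "\<And>t j s. (t, j, s) \<in> states M \<Longrightarrow> bellman M V t j s = V t j s"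
    and W: "\<And>t j s. (t, j, s) \<in> states M \<Longrightarrow> entropic_bellman M \<eta> W t j s = W t j s"
    using assms(2,3) by (auto simp: fixed_point_def)
  \<comment> \<open>In this direction the sandwich loses nothing, so the error term is
    \<open>e = 0\<close>.\<close>
  have "V t j s - W t j s \<le> 0 / (1 - discount M)"
  proof (rule bounded_family_self_improving[OF bounded_family_diff[OF bdd] _ x])
    fix d t j s
    assume d: "\<And>t j s. (t, j, s) \<in> states M \<Longrightarrow> V t j s - W t j s \<le> d"
      and y: "(t, j, s) \<in> states M"
    have "entropic_bellman M \<eta> V t j s \<le> entropic_bellman M \<eta> W t j s + discount M * d"
      using d by (intro entropic_bellman_le_add[OF y \<eta>]) (simp add: algebra_simps)
    then show "V t j s - W t j s \<le> 0 + discount M * d"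
      using bellman_le_entropic_bellman[OF y \<eta>, of V] V[OF y] W[OF y] by linarith
  qed
  then show "0 \<le> W t j s - V t j s" by simp
  show "W t j s - V t j s \<le> \<eta> * ln (grid_size M) / (1 - discount M)"
  proof (rule bounded_family_self_improving[OF bounded_family_diff[OF bdd(2,1)] _ x])
    fix d t j s
    assume d: "\<And>t j s. (t, j, s) \<in> states M \<Longrightarrow> W t j s - V t j s \<le> d"
      and y: "(t, j, s) \<in> states M"
    have "entropic_bellman M \<eta> W t j s \<le> entropic_bellman M \<eta> V t j s + discount M * d"
      using d by (intro entropic_bellman_le_add[OF y \<eta>]) (simp add: algebra_simps)
    then show "W t j s - V t j s \<le> \<eta> * ln (grid_size M) + discount M * d"
      using entropic_bellman_le_bellman[OF y \<eta>, of V] V[OF y] W[OF y] by linarith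
  qed
qed

end

theorem proposition2p1:
  fixes M :: reservoir_data and \<eta> :: real
  assumes "reservoir M" and "\<eta> > 0"
  shows
    "(\<forall>V. bounded_family M V \<longrightarrow> (\<forall>(t, j, s) \<in> states M.
        bellman M V t j s \<le> entropic_bellman M \<eta> V t j s \<and>
        entropic_bellman M \<eta> V t j s \<le> bellman M V t j s + \<eta> * ln (grid_size M)))
     \<and>
     (\<forall>V V'. bounded_family M V \<longrightarrow> bounded_family M V' \<longrightarrow>
        (\<forall>(t, j, s) \<in> states M. V t j s \<le> V' t j s) \<longrightarrow>
        (\<forall>(t, j, s) \<in> states M.
           entropic_bellman M \<eta> V t j s \<le> entropic_bellman M \<eta> V' t j s))
     \<and>
     sup_norm_contraction M (discount M) (entropic_bellman M \<eta>)
     \<and>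
     (\<forall>Vstar Veta.
        fixed_point M (bellman M) Vstar \<longrightarrow>
        fixed_point M (entropic_bellman M \<eta>) Veta \<longrightarrow>
        (\<forall>(t, j, s) \<in> states M.
           0 \<le> Veta t j s - Vstar t j s \<and>
           Veta t j s - Vstar t j s \<le> \<eta> * ln (grid_size M) / (1 - discount M)))"
proof -
  interpret reservoir M by fact
  \<comment> \<open>This is the shift estimate at \<open>d = 0\<close>.\<close>
  have mono: "entropic_bellman M \<eta> V t j s \<le> entropic_bellman M \<eta> V' t j s"
    if "\<forall>(t, j, s) \<in> states M. V t j s \<le> V' t j s" "(t, j, s) \<in> states M" for V V' t j s
    using entropic_bellman_le_add[OF that(2) assms(2), of V V' 0] that(1) by fastforce
  show ?thesis
  proof (intro conjI allI impI ballI)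
    show "case x of (t, j, s) \<Rightarrow> bellman M V t j s \<le> entropic_bellman M \<eta> V t j s \<and>
        entropic_bellman M \<eta> V t j s \<le> bellman M V t j s + \<eta> * ln (grid_size M)"
      if "x \<in> states M" for V x
      using that bellman_le_entropic_bellman[OF _ assms(2)]
        entropic_bellman_le_bellman[OF _ assms(2)] by (cases x) simp
    show "case x of (t, j, s) \<Rightarrow>
        entropic_bellman M \<eta> V t j s \<le> entropic_bellman M \<eta> V' t j s"
      if "\<forall>(t, j, s) \<in> states M. V t j s \<le> V' t j s" "x \<in> states M" for V V' x
      using mono[OF that(1)] that(2) by (cases x) simp
    show "case x of (t, j, s) \<Rightarrow> 0 \<le> Veta t j s - Vstar t j s \<and>
        Veta t j s - Vstar t j s \<le> \<eta> * ln (grid_size M) / (1 - discount M)"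
      if "fixed_point M (bellman M) Vstar" "fixed_point M (entropic_bellman M \<eta>) Veta"
        "x \<in> states M" for Vstar Veta x
      using that(3) fixed_point_gap[OF assms(2) that(1,2)] by (cases x) simp
  qed (rule entropic_bellman_contraction[OF assms(2)])
qed

end
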